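(* Let $\omega>0$ and $\gamma\in\mathbb{R}$. Then for every $c>0$ satisfying $c(\gamma-1)<2\omega\gamma$ and $c>2\omega$, there exists a nontrivial (not identically zero) smooth solitary wave solution $u(t,x)=\varphi_c(x-ct)$ of the equation $$u_t-u_{txx}+2\omega u_x+3uu_x=\gamma(2u_xu_{xx}+uu_{xxx}),\quad t>0,\ x\in\mathbb{R},$$ and its profile $\varphi_c$ decays exponentially to zero at infinity.
   Context: A smooth solitary wave solution with speed $c$ is a solution of the form $u(t,x)=\varphi_c(x-ct)$, where the profile $\varphi_c:\mathbb{R}\to\mathbb{R}$ is a smooth function tending to zero at $\pm\infty$. Equivalently, $\varphi_c$ satisfies $-c\varphi_c'+c\varphi_c'''+3\varphi_c'\varphi_c+2\omega\varphi_c'=2\gamma\varphi_c'\varphi_c''+\gamma\varphi_c\varphi_c'''$ on $\mathbb{R}$. Exponential decay to zero at infinity means that $|\varphi_c(x)|\le Ce^{-\delta|x|}$ for all $x\in\mathbb{R}$, for some constants $C,\delta>0$. *)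

theory Defs
  imports "HOL-Analysis.Analysis"
begin

definition smooth :: "(real \<Rightarrow> real) \<Rightarrow> bool" where
  "smooth f \<longleftrightarrow> (\<forall>n x. (deriv ^^ n) f field_differentiable (at x))"

text \<open>Partial derivatives of \<open>u t x\<close>. As \<^const>\<open>deriv\<close> is total, these values are meaningful
  only where the derivative exists; existence is demanded separately in \<open>solves_pde\<close>.\<close>

definition dt :: "(real \<Rightarrow> real \<Rightarrow> real) \<Rightarrow> real \<Rightarrow> real \<Rightarrow> real" where
  "dt u t x = deriv (\<lambda>s. u s x) t"

definition dx :: "(real \<Rightarrow> real \<Rightarrow> real) \<Rightarrow> real \<Rightarrow> real \<Rightarrow> real" where
  "dx u t x = deriv (\<lambda>y. u t y) x"

text \<open>Classical solutions on \<open>t > 0\<close>: every partial derivative in the equation exists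
  (\<open>u\<^sub>t\<^sub>x\<^sub>x\<close> being read as \<open>dx (dx (dt u))\<close>) and the equation holds pointwise.\<close>

definition solves_pde :: "real \<Rightarrow> real \<Rightarrow> (real \<Rightarrow> real \<Rightarrow> real) \<Rightarrow> bool" where
  "solves_pde \<omega> \<gamma> u \<longleftrightarrow> (\<forall>t>0. \<forall>x.
     (\<lambda>s. u s x) field_differentiable (at t) \<and>
     (\<lambda>y. dt u t y) field_differentiable (at x) \<and>
     (\<lambda>y. dx (dt u) t y) field_differentiable (at x) \<and>
     (\<lambda>y. u t y) field_differentiable (at x) \<and>
     (\<lambda>y. dx u t y) field_differentiable (at x) \<and>
     (\<lambda>y. dx (dx u) t y) field_differentiable (at x) \<and>
     dt u t x - dx (dx (dt u)) t x + 2 * \<omega> * dx u t x + 3 * u t x * dx u t x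
       = \<gamma> * (2 * dx u t x * dx (dx u) t x + u t x * dx (dx (dx u)) t x))"

definition smooth_solitary_wave :: "real \<Rightarrow> real \<Rightarrow> real \<Rightarrow> (real \<Rightarrow> real) \<Rightarrow> bool" where
  "smooth_solitary_wave \<omega> \<gamma> c \<phi> \<longleftrightarrow>
     smooth \<phi> \<and> (\<phi> \<longlongrightarrow> 0) at_top \<and> (\<phi> \<longlongrightarrow> 0) at_bot \<and>
     solves_pde \<omega> \<gamma> (\<lambda>t x. \<phi> (x - c * t))"

definition decays_exponentially :: "(real \<Rightarrow> real) \<Rightarrow> bool" where
  "decays_exponentially \<phi> \<longleftrightarrow> (\<exists>C>0. \<exists>\<delta>>0. \<forall>x. \<bar>\<phi> x\<bar> \<le> C * exp (- \<delta> * \<bar>x\<bar>))"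

end

theory Submission
  imports Defs
begin

text \<open>
  Write \<open>a = c - 2 * \<omega>\<close>, which is positive. Integrating the profile equation twice, with zero
  constants of integration, gives \<open>\<phi>'\<^sup>2 * (c - \<gamma> * \<phi>) = \<phi>\<^sup>2 * (a - \<phi>)\<close>. A wave of elevation thus
  has height \<open>a\<close>, and the hypothesis \<open>c * (\<gamma> - 1) < 2 * \<omega> * \<gamma>\<close> says precisely that
  \<open>c - \<gamma> * a > 0\<close>; being affine in \<open>\<phi>\<close> and positive at \<open>0\<close> and at \<open>a\<close>, the factor \<open>c - \<gamma> * \<phi>\<close> is then
  bounded away from zero along the whole wave.

  The equation degenerates at the crest \<open>\<phi> = a\<close>, where a solution through the crest is not unique
  (the constant \<open>a\<close> solves it too). The substitution \<open>\<phi> = a * (1 - tanh\<^sup>2 \<tau>)\<close>, suggested by the case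
  \<open>\<gamma> = 0\<close>, removes the degeneracy: it turns the equation into
  \<open>dx / d\<tau> = (2 / sqrt a) * sqrt (c - \<gamma> * \<phi>)\<close>, whose right-hand side is an explicit function of \<open>\<tau>\<close>
  lying between two positive constants. Hence \<open>x\<close> is obtained by one quadrature, it is a
  bijection of the line onto itself, and its inverse \<open>\<tau> = T x\<close> grows at least linearly
  (\<open>inverse_of_antiderivative\<close>). Since \<open>1 - tanh\<^sup>2 \<tau> \<le> 4 * exp (- 2 * \<bar>\<tau>\<bar>)\<close>, the profile decays
  exponentially.

  Differentiating shows that \<open>\<phi>\<close> satisfies the once integrated equation
  \<open>(c - \<gamma> * \<phi>) * \<phi>'' = a * \<phi> - 3/2 * \<phi>\<^sup>2 + \<gamma>/2 * \<phi>'\<^sup>2\<close> (\<open>solitary_profile_exists\<close>). One more derivative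
  of it is the travelling-wave equation (\<open>solves_pde_travelling_wave\<close>). It also expresses the
  derivatives of \<open>\<phi>\<close>, \<open>\<phi>'\<close> and \<open>1 / (c - \<gamma> * \<phi>)\<close> as polynomials in these same three functions, so
  the algebra they generate is closed under differentiation and \<open>\<phi>\<close> is smooth
  (\<open>smooth_of_profile_equation\<close>).
\<close>

section \<open>Smoothness from a differential algebra\<close>

inductive_set generated_algebra :: "(real \<Rightarrow> real) set \<Rightarrow> (real \<Rightarrow> real) set"
  for G :: "(real \<Rightarrow> real) set" where
  generator: "g \<in> G \<Longrightarrow> g \<in> generated_algebra G"
| const: "(\<lambda>x. k) \<in> generated_algebra G"
| add: "f \<in> generated_algebra G \<Longrightarrow> g \<in> generated_algebra G \<Longrightarrow> (\<lambda>x. f x + g x) \<in> generated_algebra G"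
| mult: "f \<in> generated_algebra G \<Longrightarrow> g \<in> generated_algebra G \<Longrightarrow> (\<lambda>x. f x * g x) \<in> generated_algebra G"

text \<open>By the sum and product rules it is enough to differentiate the generators.\<close>

lemma generated_algebra_closed_under_derivative:
  assumes gen: "\<And>g. g \<in> G \<Longrightarrow> \<exists>g' \<in> generated_algebra G. \<forall>x. (g has_real_derivative g' x) (at x)"
    and "f \<in> generated_algebra G"
  shows "\<exists>f' \<in> generated_algebra G. \<forall>x. (f has_real_derivative f' x) (at x)"
  using assms(2)
proof induction
  case (generator g)
  then show ?case by (rule gen)
next
  case (const k)
  show ?case
    by (rule bexI[of _ "\<lambda>x. 0"]) (auto intro: generated_algebra.const)
next
  case (add f g)
  then obtain f' g' where
    "f' \<in> generated_algebra G" "\<forall>x. (f has_real_derivative f' x) (at x)"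
    "g' \<in> generated_algebra G" "\<forall>x. (g has_real_derivative g' x) (at x)" by blast
  then show ?case
    by (intro bexI[of _ "\<lambda>x. f' x + g' x"]) (auto intro: generated_algebra.add DERIV_add)
next
  case (mult f g)
  then obtain f' g' where
    "f' \<in> generated_algebra G" "\<forall>x. (f has_real_derivative f' x) (at x)"
    "g' \<in> generated_algebra G" "\<forall>x. (g has_real_derivative g' x) (at x)" by blast
  with mult.hyps show ?case
    by (intro bexI[of _ "\<lambda>x. f' x * g x + g' x * f x"])
      (auto intro!: generated_algebra.intros(3,4) DERIV_mult)
qed

lemma smooth_of_closed_under_derivative:
  assumes closed: "\<And>f. f \<in> A \<Longrightarrow> \<exists>f' \<in> A. \<forall>x. (f has_real_derivative f' x) (at x)"
    and "f \<in> A"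
  shows "smooth f"
proof -
  have "(deriv ^^ n) f \<in> A" for n
  proof (induction n)
    case 0
    show ?case using \<open>f \<in> A\<close> by simp
  next
    case (Suc n)
    from closed[OF this] obtain g where
      g: "g \<in> A" "\<forall>x. ((deriv ^^ n) f has_real_derivative g x) (at x)" by blast
    then have "deriv ((deriv ^^ n) f) = g"
      by (auto intro: DERIV_imp_deriv)
    with g show ?case by simp
  qed
  with closed show ?thesis
    unfolding smooth_def field_differentiable_def by blast
qed

text \<open>The reciprocal \<open>r = 1 / (c - \<gamma> * p)\<close> is adjoined as a third generator because it makes the
  right-hand side of the profile equation polynomial, and \<open>r' = \<gamma> * r\<^sup>2 * q\<close> is polynomial as well.\<close>

lemma smooth_of_profile_equation:
  fixes p q :: "real \<Rightarrow> real" and a c \<gamma> :: real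
  assumes p: "\<And>x. (p has_real_derivative q x) (at x)"
    and q: "\<And>x. (q has_real_derivative
              (a * p x - 3/2 * (p x)\<^sup>2 + \<gamma>/2 * (q x)\<^sup>2) / (c - \<gamma> * p x)) (at x)"
    and nz: "\<And>x. c - \<gamma> * p x \<noteq> 0"
  shows "smooth p"
proof -
  define r where "r = (\<lambda>x. 1 / (c - \<gamma> * p x))"
  define A where "A = generated_algebra {p, q, r}"
  have pA: "p \<in> A" and qA: "q \<in> A" and rA: "r \<in> A"
    unfolding A_def by (auto intro: generated_algebra.generator)
  note algebra = generated_algebra.const[of _ "{p, q, r}", folded A_def]
    generated_algebra.add[of _ "{p, q, r}", folded A_def]
    generated_algebra.mult[of _ "{p, q, r}", folded A_def]
  have r': "(r has_real_derivative \<gamma> * (r x * (r x * q x))) (at x)" for x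
    unfolding r_def using nz[of x]
    by (auto intro!: derivative_eq_intros p simp: field_simps power2_eq_square)
  have q': "(q has_real_derivative
      r x * (a * p x + ((-3/2) * (p x * p x) + \<gamma>/2 * (q x * q x)))) (at x)" for x
    by (rule DERIV_cong[OF q]) (simp add: r_def power2_eq_square)
  have "\<exists>g' \<in> A. \<forall>x. (g has_real_derivative g' x) (at x)" if "g \<in> {p, q, r}" for g
  proof -
    from that consider "g = p" | "g = q" | "g = r" by blast
    then show ?thesis
    proof cases
      case 1
      then show ?thesis using p qA by blast
    next
      case 2
      show ?thesis unfolding 2
        by (rule bexI[of _ "\<lambda>x. r x * (a * p x + ((-3/2) * (p x * p x) + \<gamma>/2 * (q x * q x)))"])
          (intro allI q' algebra pA qA rA)+
    next
      case 3
      show ?thesis unfolding 3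
        by (rule bexI[of _ "\<lambda>x. \<gamma> * (r x * (r x * q x))"]) (intro allI r' algebra qA rA)+
    qed
  qed
  then have "\<exists>f' \<in> A. \<forall>x. (f has_real_derivative f' x) (at x)" if "f \<in> A" for f
    using generated_algebra_closed_under_derivative[of "{p, q, r}"] that unfolding A_def by blast
  then show ?thesis
    using pA by (rule smooth_of_closed_under_derivative)
qed

section \<open>From the profile equation to the partial differential equation\<close>

text \<open>Solved for \<open>p''\<close>, the profile equation shows that \<open>p''\<close> is a quotient of differentiable
  functions, so a third derivative exists. Differentiating the equation in the form
  \<open>p'' * (c - \<gamma> * p) = \<dots>\<close> then yields the travelling-wave equation.\<close>

lemma solves_pde_travelling_wave:
  fixes p q :: "real \<Rightarrow> real" and \<omega> c \<gamma> :: real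
  defines "s \<equiv> \<lambda>x. ((c - 2 * \<omega>) * p x - 3/2 * (p x)\<^sup>2 + \<gamma>/2 * (q x)\<^sup>2) / (c - \<gamma> * p x)"
  assumes p: "\<And>x. (p has_real_derivative q x) (at x)"
    and q: "\<And>x. (q has_real_derivative s x) (at x)"
    and nz: "\<And>x. c - \<gamma> * p x \<noteq> 0"
  shows "solves_pde \<omega> \<gamma> (\<lambda>t x. p (x - c * t))"
proof -
  define d where "d = (\<lambda>x. ((c - 2 * \<omega>) * q x - 3 * p x * q x + 2 * \<gamma> * q x * s x) / (c - \<gamma> * p x))"
  have s: "(s has_real_derivative d x) (at x)" for x
  proof -
    have num: "((\<lambda>x. (c - 2 * \<omega>) * p x - 3/2 * (p x)\<^sup>2 + \<gamma>/2 * (q x)\<^sup>2) has_real_derivative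
        (c - 2 * \<omega>) * q x - 3 * p x * q x + \<gamma> * q x * s x) (at x)"
      by (auto intro!: derivative_eq_intros p q)
    have den: "((\<lambda>x. c - \<gamma> * p x) has_real_derivative - \<gamma> * q x) (at x)"
      by (auto intro!: derivative_eq_intros p)
    let ?n = "(c - 2 * \<omega>) * p x - 3/2 * (p x)\<^sup>2 + \<gamma>/2 * (q x)\<^sup>2"
    let ?n' = "(c - 2 * \<omega>) * q x - 3 * p x * q x + \<gamma> * q x * s x"
    let ?D = "c - \<gamma> * p x"
    have "(s has_real_derivative (?n' * ?D - ?n * (- \<gamma> * q x)) / (?D * ?D)) (at x)"
      unfolding s_def using DERIV_divide[OF num den nz] unfolding s_def .
    moreover have "?n = s x * ?D"
      using nz[of x] by (simp add: s_def)
    then have "?n' * ?D - ?n * (- \<gamma> * q x) = (?n' + \<gamma> * q x * s x) * ?D"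
      by (simp only:) (simp add: algebra_simps)
    then have "(?n' * ?D - ?n * (- \<gamma> * q x)) / (?D * ?D) = (?n' + \<gamma> * q x * s x) / ?D"
      by (simp only: mult_divide_mult_cancel_right[OF nz])
    then have "(?n' * ?D - ?n * (- \<gamma> * q x)) / (?D * ?D) = d x"
      by (simp add: d_def)
    ultimately show ?thesis by simp
  qed
  have in_x: "((\<lambda>y. f (y - c * t)) has_real_derivative f' (x - c * t)) (at x)"
    if "\<And>x. (f has_real_derivative f' x) (at x)" for f f' t x
    by (rule DERIV_cong[OF DERIV_chain2[OF that]]) (auto intro!: derivative_eq_intros)
  have in_t: "((\<lambda>t. p (x - c * t)) has_real_derivative - c * q (x - c * t)) (at t)" for t x
    by (rule DERIV_cong[OF DERIV_chain2[OF p]]) (auto intro!: derivative_eq_intros)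
  have scaled_x: "((\<lambda>y. - c * f (y - c * t)) has_real_derivative - c * f' (x - c * t)) (at x)"
    if "\<And>x. (f has_real_derivative f' x) (at x)" for f f' t x
    by (rule DERIV_cmult[OF in_x[OF that]])
  let ?u = "\<lambda>t x. p (x - c * t)"
  have dt: "dt ?u = (\<lambda>t x. - c * q (x - c * t))"
    unfolding dt_def by (intro ext DERIV_imp_deriv in_t)
  have dx: "dx (\<lambda>t x. f (x - c * t)) = (\<lambda>t x. f' (x - c * t))"
    if "\<And>x. (f has_real_derivative f' x) (at x)" for f f'
    unfolding dx_def by (intro ext DERIV_imp_deriv in_x that)
  have dx_scaled: "dx (\<lambda>t x. - c * f (x - c * t)) = (\<lambda>t x. - c * f' (x - c * t))"
    if "\<And>x. (f has_real_derivative f' x) (at x)" for f f'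
    unfolding dx_def by (intro ext DERIV_imp_deriv scaled_x that)
  have profile: "- c * q x + c * d x + 2 * \<omega> * q x + 3 * p x * q x
      = \<gamma> * (2 * q x * s x + p x * d x)" for x
  proof -
    have "d x * (c - \<gamma> * p x) = (c - 2 * \<omega>) * q x - 3 * p x * q x + 2 * \<gamma> * q x * s x"
      using nz[of x] by (simp add: d_def)
    then show ?thesis by (simp add: algebra_simps)
  qed
  show ?thesis
    unfolding solves_pde_def dt dx[OF p] dx[OF q] dx[OF s] dx_scaled[OF q] dx_scaled[OF s]
      field_differentiable_def
  proof (intro allI impI conjI)
    fix t x
    show "- c * q (x - c * t) - - c * d (x - c * t) + 2 * \<omega> * q (x - c * t)
        + 3 * p (x - c * t) * q (x - c * t)
      = \<gamma> * (2 * q (x - c * t) * s (x - c * t) + p (x - c * t) * d (x - c * t))"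
      using profile[of "x - c * t"] by simp
  qed (rule exI, rule in_t scaled_x[OF q] scaled_x[OF s] in_x[OF p] in_x[OF q] in_x[OF s])+
qed

section \<open>Construction of the profile\<close>

text \<open>The function \<open>T\<close> inverts the antiderivative \<open>X\<close> of \<open>f\<close> that vanishes at \<open>0\<close>. The lower bound
  on \<open>f\<close> makes \<open>X\<close> a bijection of the whole line, so that \<open>T\<close> is a global solution of
  \<open>T' = 1 / f T\<close>; the upper bound keeps \<open>X\<close> from growing faster than linearly, hence \<open>T\<close> from
  growing more slowly.\<close>

lemma inverse_of_antiderivative:
  fixes f :: "real \<Rightarrow> real"
  assumes cont: "\<And>t. isCont f t" and "m > 0"
    and lower: "\<And>t. m \<le> f t" and upper: "\<And>t. f t \<le> M"
  obtains T where "\<And>x. (T has_real_derivative 1 / f (T x)) (at x)"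
    and "\<And>x. \<bar>x\<bar> \<le> M * \<bar>T x\<bar>"
proof -
  obtain F where F: "\<And>t. (F has_real_derivative f t) (at t)"
    using einterval_antiderivative[of "-\<infinity>" \<infinity> f] cont
    by (auto simp: has_real_derivative_iff_has_vector_derivative)
  define X where "X = (\<lambda>t. F t - F 0)"
  have X: "(X has_real_derivative f t) (at t)" for t
    unfolding X_def by (auto intro!: derivative_eq_intros F)
  have X0: "X 0 = 0" by (simp add: X_def)
  have fpos: "f t > 0" for t using lower[of t] \<open>m > 0\<close> by simp
  have contX: "isCont X t" for t using X by (rule DERIV_isCont)
  have mono: "X s < X t" if "s < t" for s t
    by (rule DERIV_pos_imp_increasing[OF that]) (use X fpos in blast)
  have slope: "\<exists>z. X t = t * f z" for t
  proof (cases t "0 :: real" rule: linorder_cases)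
    case less
    then show ?thesis using MVT2[OF less X] X0 by auto
  next
    case equal
    then show ?thesis using X0 by simp
  next
    case greater
    then show ?thesis using MVT2[OF greater X] X0 by auto
  qed
  have growth: "\<bar>X t\<bar> \<le> M * \<bar>t\<bar>" for t
  proof -
    obtain z where "X t = t * f z" using slope by blast
    then show ?thesis
      using fpos[of z] upper[of z] by (simp add: abs_mult mult.commute[of M] mult_left_mono)
  qed
  have surj: "\<exists>t. X t = x" for x
  proof -
    define b where "b = \<bar>x\<bar> / m"
    have b: "b \<ge> 0" "b * m = \<bar>x\<bar>" using \<open>m > 0\<close> by (auto simp: b_def)
    obtain y z where "X b = b * f y" "X (- b) = - b * f z" using slope by metis
    moreover have "b * m \<le> b * f y" "b * m \<le> b * f z"
      by (intro mult_left_mono lower b)+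
    ultimately have "X (- b) \<le> x" "x \<le> X b" using b by auto
    then show ?thesis
      using IVT[of X "- b" x b] b contX by auto
  qed
  define T where "T = (\<lambda>x. THE t. X t = x)"
  have XT: "X (T x) = x" for x
    unfolding T_def by (rule theI') (metis surj mono linorder_neqE order_less_irrefl)
  have TX: "T (X t) = t" for t
    using XT[of "X t"] mono by (metis linorder_neqE order_less_irrefl)
  have contT: "isCont T x" for x
  proof -
    have "isCont T (X (T x))"
      by (rule isCont_inverse_function[of 1]) (auto simp: TX contX)
    then show ?thesis by (simp add: XT)
  qed
  show thesis
  proof
    show "(T has_real_derivative 1 / f (T x)) (at x)" for x
      by (rule DERIV_cong[OF DERIV_inverse_function[where f = X and a = "x - 1" and b = "x + 1"]])
        (use X fpos[of "T x"] XT contT in \<open>auto simp: inverse_eq_divide\<close>)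
    show "\<bar>x\<bar> \<le> M * \<bar>T x\<bar>" for x
      using growth[of "T x"] by (simp add: XT)
  qed
qed

lemma one_minus_tanh_squared_le:
  fixes t :: real
  shows "1 - (tanh t)\<^sup>2 \<le> 4 * exp (- 2 * \<bar>t\<bar>)"
proof -
  have "exp \<bar>t\<bar> \<le> 2 * cosh t"
    by (cases "t \<ge> 0") (auto simp: cosh_def)
  then have "(exp \<bar>t\<bar>)\<^sup>2 \<le> (2 * cosh t)\<^sup>2"
    by (intro power_mono) auto
  then have e: "exp (2 * \<bar>t\<bar>) \<le> 4 * (cosh t)\<^sup>2"
    by (simp add: power_mult_distrib exp_double)
  have "1 - (tanh t)\<^sup>2 = 1 / (cosh t)\<^sup>2"
  proof -
    have "1 - (tanh t)\<^sup>2 = ((cosh t)\<^sup>2 - (sinh t)\<^sup>2) / (cosh t)\<^sup>2"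
      by (simp add: tanh_def power_divide diff_divide_distrib)
    then show ?thesis by (simp add: cosh_square_eq)
  qed
  also have "\<dots> \<le> 4 / exp (2 * \<bar>t\<bar>)"
    using e cosh_real_pos[of t] by (simp add: field_simps)
  finally show ?thesis by (simp add: exp_minus field_simps)
qed

lemma affine_pos_between:
  fixes a c \<gamma> :: real
  assumes "c > 0" "c - \<gamma> * a > 0" "0 \<le> p" "p \<le> a"
  shows "min c (c - \<gamma> * a) \<le> c - \<gamma> * p" and "c - \<gamma> * p \<le> max c (c - \<gamma> * a)"
proof -
  have "\<gamma> * p \<le> \<gamma> * a \<and> 0 \<le> \<gamma> * p" if "\<gamma> \<ge> 0"
    using that assms by (auto intro: mult_left_mono)
  moreover have "\<gamma> * a \<le> \<gamma> * p \<and> \<gamma> * p \<le> 0" if "\<gamma> \<le> 0"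
    using that assms by (auto intro: mult_left_mono_neg mult_nonpos_nonneg)
  ultimately show "min c (c - \<gamma> * a) \<le> c - \<gamma> * p" and "c - \<gamma> * p \<le> max c (c - \<gamma> * a)"
    by (cases "\<gamma> \<ge> 0"; simp add: min_def max_def; linarith)+
qed

text \<open>With \<open>v = tanh T\<close>, \<open>w = 1 / sqrt (c - \<gamma> * p)\<close> and \<open>b = sqrt a\<close>, the derivatives of \<open>v\<close>, \<open>p\<close>
  and \<open>w\<close> are polynomials in \<open>v\<close>, \<open>p\<close> and \<open>w\<close>. The profile equation is then a polynomial identity
  modulo \<open>p = b\<^sup>2 * (1 - v\<^sup>2)\<close> and \<open>w\<^sup>2 * (c - \<gamma> * p) = 1\<close>. Working with \<open>v\<close>, which changes sign at the
  crest, avoids a division by \<open>p'\<close>, which vanishes there.\<close>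

lemma solitary_profile_exists:
  fixes a c \<gamma> :: real
  assumes "a > 0" and "c > 0" and crest: "c - \<gamma> * a > 0"
  obtains p q :: "real \<Rightarrow> real" where
    "\<And>x. (p has_real_derivative q x) (at x)"
    "\<And>x. (q has_real_derivative
       (a * p x - 3/2 * (p x)\<^sup>2 + \<gamma>/2 * (q x)\<^sup>2) / (c - \<gamma> * p x)) (at x)"
    "\<And>x. c - \<gamma> * p x > 0" "\<And>x. p x > 0" "decays_exponentially p"
proof -
  define P where "P = (\<lambda>t::real. a * (1 - (tanh t)\<^sup>2))"
  have tanh2: "(tanh t)\<^sup>2 < 1" for t :: real
    using tanh_real_bounds[of t] by (simp add: abs_square_less_1 abs_less_iff)
  have P: "0 < P t" "P t \<le> a" for t
    using tanh2[of t] \<open>a > 0\<close> by (auto simp: P_def mult_le_cancel_left1)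
  define m where "m = min c (c - \<gamma> * a)"
  define M where "M = max c (c - \<gamma> * a)"
  have "m > 0" "M > 0" using assms by (auto simp: m_def M_def)
  have between: "m \<le> c - \<gamma> * P t" "c - \<gamma> * P t \<le> M" for t
    unfolding m_def M_def
    by (intro affine_pos_between[OF \<open>c > 0\<close> crest] less_imp_le[OF P(1)] P(2))+
  define b where "b = sqrt a"
  have b: "b > 0" "b\<^sup>2 = a" using \<open>a > 0\<close> by (auto simp: b_def)
  define f where "f = (\<lambda>t. 2 / b * sqrt (c - \<gamma> * P t))"
  have cont: "isCont f t" for t
    unfolding f_def P_def by (intro continuous_intros) auto
  have bounds: "2 / b * sqrt m \<le> f t" "f t \<le> 2 / b * sqrt M" for t
    unfolding f_def using between[of t] b by (auto simp: divide_right_mono)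
  have "2 / b * sqrt m > 0" using b \<open>m > 0\<close> by simp
  then obtain T where T: "\<And>x. (T has_real_derivative 1 / f (T x)) (at x)"
    and grow: "\<And>x. \<bar>x\<bar> \<le> 2 / b * sqrt M * \<bar>T x\<bar>"
    using inverse_of_antiderivative[OF cont _ bounds] by blast
  define v where "v = (\<lambda>x. tanh (T x))"
  define p where "p = (\<lambda>x. P (T x))"
  define w where "w = (\<lambda>x. 1 / sqrt (c - \<gamma> * p x))"
  \<comment> \<open>The square root of \<open>(a - p) / (c - \<gamma> * p)\<close>, times \<open>p\<close>, with the sign that makes the
    wave rise before its crest at \<open>T x = 0\<close> and fall after it.\<close>
  define q where "q = (\<lambda>x. - b * (v x * p x * w x))"
  have pos: "c - \<gamma> * p x > 0" for x
    using between[of "T x"] \<open>m > 0\<close> by (simp add: p_def)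
  have pv: "p x = b\<^sup>2 * (1 - (v x)\<^sup>2)" for x by (simp add: p_def P_def v_def b)
  have wpos: "w x > 0" and w2: "(w x)\<^sup>2 * (c - \<gamma> * p x) = 1" for x
    using pos[of x] by (auto simp: w_def power_divide)
  have v': "(v has_real_derivative b / 2 * (1 - (v x)\<^sup>2) * w x) (at x)" for x
  proof -
    have "cosh (T x) \<noteq> 0" by simp
    then have "(v has_real_derivative (1 - (tanh (T x))\<^sup>2) * (1 / f (T x))) (at x)"
      unfolding v_def by (auto intro!: derivative_eq_intros T)
    then show ?thesis
      by (rule DERIV_cong) (simp add: v_def w_def f_def p_def field_simps)
  qed
  have p': "(p has_real_derivative q x) (at x)" for x
  proof -
    have "(p has_real_derivative b\<^sup>2 * (- (2 * v x * (b / 2 * (1 - (v x)\<^sup>2) * w x)))) (at x)"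
      unfolding pv by (auto intro!: derivative_eq_intros v')
    then show ?thesis
      by (rule DERIV_cong) (simp add: q_def pv power2_eq_square algebra_simps)
  qed
  have w': "(w has_real_derivative \<gamma> / 2 * q x * w x ^ 3) (at x)" for x
  proof -
    have "(w has_real_derivative
        - (- (\<gamma> * q x) * inverse (sqrt (c - \<gamma> * p x)) / 2) / (sqrt (c - \<gamma> * p x))\<^sup>2) (at x)"
      unfolding w_def using pos[of x]
      by (auto intro!: derivative_eq_intros p' simp: field_simps power2_eq_square)
    then show ?thesis
      by (rule DERIV_cong) (simp add: w_def field_simps power2_eq_square power3_eq_cube)
  qed
  have q': "(q has_real_derivative
      (a * p x - 3/2 * (p x)\<^sup>2 + \<gamma>/2 * (q x)\<^sup>2) / (c - \<gamma> * p x)) (at x)" for x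
  proof -
    let ?v' = "b / 2 * (1 - (v x)\<^sup>2) * w x"
    let ?w' = "\<gamma> / 2 * q x * w x ^ 3"
    have "((\<lambda>x. - b * (v x * p x * w x)) has_real_derivative
        - b * (?v' * p x * w x + v x * q x * w x + v x * p x * ?w')) (at x)"
      by (rule derivative_eq_intros v' p' w' refl | simp add: algebra_simps)+
    then have "(q has_real_derivative
        - b * (?v' * p x * w x + v x * q x * w x + v x * p x * ?w')) (at x)"
      unfolding q_def[symmetric] .
    moreover have "- b * (?v' * p x * w x + v x * q x * w x + v x * p x * ?w')
        = (w x)\<^sup>2 * (a * p x - 3/2 * (p x)\<^sup>2 + \<gamma>/2 * (q x)\<^sup>2)"
    proof -
      have "b * ?v' = p x * w x / 2"
        by (simp add: pv power2_eq_square)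
      then have "- b * (?v' * p x * w x) = - (p x * w x / 2) * p x * w x"
        by (simp only: mult_minus_left mult.assoc[symmetric])
      then have e1: "- b * (?v' * p x * w x) = - (w x)\<^sup>2 * (p x)\<^sup>2 / 2"
        by (simp add: power2_eq_square)
      have e2: "- b * (v x * q x * w x) = (w x)\<^sup>2 * (a * p x - (p x)\<^sup>2)"
      proof -
        have "b\<^sup>2 * (v x)\<^sup>2 = a - p x" by (simp add: pv b algebra_simps)
        moreover have "- b * (v x * q x * w x) = (w x)\<^sup>2 * (p x * (b\<^sup>2 * (v x)\<^sup>2))"
          by (simp add: q_def power2_eq_square)
        ultimately have "- b * (v x * q x * w x) = (w x)\<^sup>2 * (p x * (a - p x))"
          by simp
        then show ?thesis by (simp add: power2_eq_square algebra_simps)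
      qed
      have e3: "- b * (v x * p x * ?w') = (w x)\<^sup>2 * (\<gamma>/2 * (q x)\<^sup>2)"
        by (simp add: q_def power2_eq_square power3_eq_cube)
      show ?thesis
        by (simp only: distrib_left e1 e2 e3) (simp add: algebra_simps)
    qed
    moreover have "(w x)\<^sup>2 = 1 / (c - \<gamma> * p x)"
      using w2[of x] pos[of x] by (simp add: field_simps)
    ultimately show ?thesis by simp
  qed
  have decay: "decays_exponentially p"
  proof -
    define \<delta> where "\<delta> = b / sqrt M"
    have "\<delta> > 0" using b \<open>M > 0\<close> by (simp add: \<delta>_def)
    have "\<bar>p x\<bar> \<le> 4 * a * exp (- \<delta> * \<bar>x\<bar>)" for x
    proof -
      have "\<delta> * \<bar>x\<bar> \<le> \<delta> * (2 / b * sqrt M * \<bar>T x\<bar>)"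
        using grow[of x] \<open>\<delta> > 0\<close> by (intro mult_left_mono) auto
      also have "\<dots> = 2 * \<bar>T x\<bar>"
        using b \<open>M > 0\<close> by (simp add: \<delta>_def)
      finally have "exp (- 2 * \<bar>T x\<bar>) \<le> exp (- \<delta> * \<bar>x\<bar>)" by simp
      then have "1 - (tanh (T x))\<^sup>2 \<le> 4 * exp (- \<delta> * \<bar>x\<bar>)"
        using one_minus_tanh_squared_le[of "T x"] by linarith
      then have "a * (1 - (tanh (T x))\<^sup>2) \<le> a * (4 * exp (- \<delta> * \<bar>x\<bar>))"
        using \<open>a > 0\<close> by (intro mult_left_mono) auto
      then show ?thesis
        using P(1)[of "T x"] by (simp add: p_def P_def mult.assoc mult.left_commute)
    qed
    then show ?thesis
      unfolding decays_exponentially_def using \<open>a > 0\<close> \<open>\<delta> > 0\<close>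
      by (intro exI[of _ "4 * a"] exI[of _ \<delta>] conjI) auto
  qed
  show thesis
    using that[OF p' q' pos _ decay] P(1) by (simp add: p_def)
qed

section \<open>Existence of solitary waves\<close>

lemma decays_exponentially_tendsto_zero:
  assumes "decays_exponentially f"
  shows "(f \<longlongrightarrow> 0) at_top" and "(f \<longlongrightarrow> 0) at_bot"
proof -
  obtain C \<delta> where "\<delta> > 0" and bound: "\<And>x. \<bar>f x\<bar> \<le> C * exp (- \<delta> * \<bar>x\<bar>)"
    using assms unfolding decays_exponentially_def by blast
  have lim: "((\<lambda>x. C * exp (- \<delta> * \<bar>x\<bar>)) \<longlongrightarrow> 0) F"
    if "filterlim (\<lambda>x::real. \<bar>x\<bar>) at_top F" for F
  proof -
    have "filterlim (\<lambda>x. - \<delta> * \<bar>x\<bar>) at_bot F"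
      using \<open>\<delta> > 0\<close> that
      by (intro filterlim_tendsto_neg_mult_at_bot[of _ "- \<delta>"]) auto
    then have "((\<lambda>x. C * exp (- \<delta> * \<bar>x\<bar>)) \<longlongrightarrow> C * 0) F"
      by (intro tendsto_intros filterlim_compose[OF exp_at_bot])
    then show ?thesis by simp
  qed
  show "(f \<longlongrightarrow> 0) at_top"
    by (rule Lim_null_comparison[OF _ lim[OF filterlim_abs_real]]) (use bound in auto)
  have "filterlim (\<lambda>x::real. \<bar>x\<bar>) at_top at_bot"
    using filterlim_abs_real by (simp add: filterlim_at_bot_mirror)
  then show "(f \<longlongrightarrow> 0) at_bot"
    by (intro Lim_null_comparison[OF _ lim]) (use bound in auto)
qed

theorem theorem2:
  fixes \<omega> \<gamma> c :: real
  assumes "\<omega> > 0" and "c > 0" and "c * (\<gamma> - 1) < 2 * \<omega> * \<gamma>" and "c > 2 * \<omega>"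
  shows "\<exists>\<phi>. smooth_solitary_wave \<omega> \<gamma> c \<phi> \<and> (\<exists>x. \<phi> x \<noteq> 0) \<and> decays_exponentially \<phi>"
proof -
  have "c - 2 * \<omega> > 0" "c - \<gamma> * (c - 2 * \<omega>) > 0"
    using assms by (auto simp: algebra_simps)
  with \<open>c > 0\<close> obtain p q :: "real \<Rightarrow> real" where
    p': "\<And>x. (p has_real_derivative q x) (at x)" and
    q': "\<And>x. (q has_real_derivative
       ((c - 2 * \<omega>) * p x - 3/2 * (p x)\<^sup>2 + \<gamma>/2 * (q x)\<^sup>2) / (c - \<gamma> * p x)) (at x)" and
    pos: "\<And>x. c - \<gamma> * p x > 0" and ppos: "\<And>x. p x > 0" and decay: "decays_exponentially p"
    using solitary_profile_exists[of "c - 2 * \<omega>" c \<gamma>] by blast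
  have nz: "c - \<gamma> * p x \<noteq> 0" for x using pos[of x] by simp
  have "smooth_solitary_wave \<omega> \<gamma> c p"
    unfolding smooth_solitary_wave_def
    using smooth_of_profile_equation[OF p' q' nz] decays_exponentially_tendsto_zero[OF decay]
      solves_pde_travelling_wave[OF p' q' nz] by blast
  moreover have "p 0 \<noteq> 0" using ppos[of 0] by simp
  ultimately show ?thesis using decay by blast
qed

end
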